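(* Let $n\ge1$ and $L\ge0$ be integers. There is a constant $C=C(L,n)$ depending only on $L$ and $n$ such that the following holds. For every integer $d\ge1$, every $d$-maximal set $S\subset[n]^\infty$ containing no $(L+1)$-ball, and every integer $\ell\ge0$, \[ \bigl|S^{(\ell)}\bigr|\le C\,d^{2L+2}\,(n+8n^{2/3})^d . \]
   Context: $[n]=\{1,\dots,n\}$, $[n]^\infty$ is the set of infinite sequences over $[n]$, $\mathrm{dist}(a,b)=|\{i:a_i\ne b_i\}|$ is the Hamming distance, $\mathrm{diam}(S)=\sup_{a,b\in S}\mathrm{dist}(a,b)$. $S$ is $d$-maximal if $\mathrm{diam}(S)=d$ and $S$ is inclusion-maximal among subsets of $[n]^\infty$ of diameter $d$. $\mathrm{Ball}(a,r)=\{b\in[n]^\infty:\mathrm{dist}(a,b)\le r\}$; an $r$-ball is such a set, and $S$ contains an $r$-ball if $\mathrm{Ball}(a,r)\subset S$ for some $a$. For $S\subset[n]^\infty$, \[ S^{(\ell)}=\{a\in S:\ \mathrm{Ball}(a,\ell)\subset S,\ \text{and there is no } b\in[n]^\infty \text{ with } \mathrm{Ball}(a,\ell)\subset\mathrm{Ball}(b,\ell+1)\subset S\}. \] *)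

theory Defs
  imports "HOL-Analysis.Analysis" "HOL-Library.Extended_Nat" "HOL-Library.FuncSet"
begin

definition seqs :: "nat \<Rightarrow> (nat \<Rightarrow> nat) set" where
  "seqs n = UNIV \<rightarrow> {1..n}"

definition hdist :: "(nat \<Rightarrow> nat) \<Rightarrow> (nat \<Rightarrow> nat) \<Rightarrow> enat" where
  "hdist a b = (if finite {i. a i \<noteq> b i} then enat (card {i. a i \<noteq> b i}) else \<infinity>)"

definition hdiam :: "(nat \<Rightarrow> nat) set \<Rightarrow> enat" where
  "hdiam S = (SUP (a, b) \<in> S \<times> S. hdist a b)"

definition maximal_diam :: "nat \<Rightarrow> nat \<Rightarrow> (nat \<Rightarrow> nat) set \<Rightarrow> bool" where
  "maximal_diam n d S \<longleftrightarrow>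
     S \<subseteq> seqs n \<and> hdiam S = enat d \<and>
     (\<forall>T. T \<subseteq> seqs n \<and> hdiam T = enat d \<and> S \<subseteq> T \<longrightarrow> T = S)"

definition hball :: "nat \<Rightarrow> (nat \<Rightarrow> nat) \<Rightarrow> nat \<Rightarrow> (nat \<Rightarrow> nat) set" where
  "hball n a r = {b \<in> seqs n. hdist a b \<le> enat r}"

definition contains_ball :: "nat \<Rightarrow> nat \<Rightarrow> (nat \<Rightarrow> nat) set \<Rightarrow> bool" where
  "contains_ball n r S \<longleftrightarrow> (\<exists>a \<in> seqs n. hball n a r \<subseteq> S)"

definition level_set :: "nat \<Rightarrow> (nat \<Rightarrow> nat) set \<Rightarrow> nat \<Rightarrow> (nat \<Rightarrow> nat) set" where
  "level_set n S l =
     {a \<in> S. hball n a l \<subseteq> S \<and>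
        \<not> (\<exists>b \<in> seqs n. hball n a l \<subseteq> hball n b (l + 1) \<and> hball n b (l + 1) \<subseteq> S)}"

end

theory Submission
  imports Defs
begin

text \<open>Fix \<open>x, s \<in> S\<close> at distance \<open>d\<close> and reveal an element \<open>a\<close> of the level set first on the \<open>d\<close>
  coordinates \<open>D\<close> where \<open>x\<close> and \<open>s\<close> differ.  If \<open>a\<close> differs from \<open>x\<close> in \<open>k\<close> places outside \<open>D\<close>, then
  on \<open>D\<close> it agrees at least \<open>k\<close> times with \<open>x\<close> and at least \<open>k\<close> times with \<open>s\<close>, which saves a factor
  of about \<open>n ^ (2 * k)\<close>.  The \<open>k\<close> remaining differences are located by repeatedly comparing the
  current approximation \<open>b\<close> of \<open>a\<close> with a far element of \<open>S\<close>: as \<open>S\<close> contains no ball of radius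
  \<open>L + 1\<close>, each comparison exposes, up to \<open>L\<close>, half of the remaining differences among at most
  \<open>d / 2\<close> new coordinates.  This costs about \<open>(2 * n / \<delta>) ^ k * exp (\<delta> * d)\<close> choices, and
  \<open>\<delta> = n powr (-1/3) / 2\<close> balances the two effects.  The last \<open>L\<close> differences are found one at a
  time, using that \<open>a\<close> is in the level set.\<close>

section \<open>Difference sets and the triangle inequality\<close>

definition dif :: "(nat \<Rightarrow> nat) \<Rightarrow> (nat \<Rightarrow> nat) \<Rightarrow> nat set" where
  "dif a b = {i. a i \<noteq> b i}"

lemma dif_commute: "dif a b = dif b a"
  by (auto simp: dif_def)

lemma hdist_le_iff: "hdist a b \<le> enat k \<longleftrightarrow> finite (dif a b) \<and> card (dif a b) \<le> k"
  by (simp add: hdist_def dif_def)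

lemma dif_triangle: "dif a c \<subseteq> dif a b \<union> dif b c"
  by (auto simp: dif_def)

lemma finite_dif_trans:
  "finite (dif a b) \<Longrightarrow> finite (dif b c) \<Longrightarrow> finite (dif a c)"
  by (meson dif_triangle finite_UnI finite_subset)

lemma card_dif_triangle:
  assumes "finite (dif a b)" "finite (dif b c)"
  shows "card (dif a c) \<le> card (dif a b) + card (dif b c)"
  by (meson assms card_Un_le card_mono dif_triangle finite_UnI le_trans)

text \<open>A coordinate lying in exactly one of \<open>dif a b\<close> and \<open>dif b s\<close>
  lies in \<open>dif a s\<close>. Used with \<open>b\<close> far from \<open>s\<close> and
  \<open>a\<close> near \<open>s\<close>: many differences between \<open>a\<close> and
  \<open>b\<close> must then sit inside the known set \<open>dif b s\<close>.\<close>

lemma card_dif_ge: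
  assumes "finite (dif a b)" "finite (dif b s)"
  shows "card (dif b s) + card (dif a b)
           \<le> card (dif a s) + 2 * card (dif a b \<inter> dif b s)"
proof -
  let ?I = "dif a b \<inter> dif b s"
  have fin: "finite (dif a s)" using assms finite_dif_trans by blast
  have "card (dif b s - ?I) + card (dif a b - ?I)
          = card ((dif b s - ?I) \<union> (dif a b - ?I))"
    using assms by (intro card_Un_disjoint [symmetric]) auto
  also have "\<dots> \<le> card (dif a s)"
    using fin by (intro card_mono) (auto simp: dif_def)
  finally have "card (dif b s - ?I) + card (dif a b - ?I) \<le> card (dif a s)" .
  moreover have "card (dif b s - ?I) = card (dif b s) - card ?I"
    "card (dif a b - ?I) = card (dif a b) - card ?I"
    using assms by (auto intro!: card_Diff_subset)
  moreover have "card ?I \<le> card (dif b s)" "card ?I \<le> card (dif a b)"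
    using assms by (auto intro!: card_mono)
  ultimately show ?thesis by linarith
qed

lemma seqs_iff: "a \<in> seqs n \<longleftrightarrow> (\<forall>i. a i \<in> {1..n})"
  by (auto simp: seqs_def)

lemma power_card_filter:
  fixes r :: "'a :: comm_semiring_1"
  assumes "finite E"
  shows "r ^ card {j \<in> E. P j} = (\<Prod>j\<in>E. if P j then r else 1)"
  using assms by (simp flip: prod.inter_filter)

section \<open>Balls, level sets and spheres in a maximal set\<close>

locale max_diam_set =
  fixes n d :: nat and S :: "(nat \<Rightarrow> nat) set"
  assumes S_seqs: "S \<subseteq> seqs n"
    and diam: "\<And>a b. a \<in> S \<Longrightarrow> b \<in> S \<Longrightarrow> finite (dif a b) \<and> card (dif a b) \<le> d"
    and maximal: "\<And>y. y \<in> seqs n \<Longrightarrow>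
      (\<And>s. s \<in> S \<Longrightarrow> finite (dif y s) \<and> card (dif y s) \<le> d) \<Longrightarrow> y \<in> S"
    and two_le: "2 \<le> n"
begin

text \<open>Triangle inequality plus maximality. Read contrapositively, it turns a missing ball into
  an \<open>s\<close> in \<open>S\<close> with \<open>d < card (dif b s) + r\<close>.\<close>

lemma ball_subset:
  assumes "\<And>s. s \<in> S \<Longrightarrow> finite (dif b s) \<and> card (dif b s) + r \<le> d"
  shows "hball n b r \<subseteq> S"
proof
  fix y assume y: "y \<in> hball n b r"
  show "y \<in> S"
  proof (rule maximal)
    show "y \<in> seqs n" using y by (simp add: hball_def)
    fix s assume s: "s \<in> S"
    have "finite (dif y b)" "card (dif y b) \<le> r"
      using y by (auto simp: hball_def hdist_le_iff dif_commute)
    then show "finite (dif y s) \<and> card (dif y s) \<le> d"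
      using assms [OF s] finite_dif_trans [of y b s] card_dif_triangle [of y b s] by linarith
  qed
qed

text \<open>Altering \<open>a\<close> in \<open>l\<close> places where it agrees with
  \<open>s\<close> stays inside the ball around \<open>a\<close>, hence in \<open>S\<close>, and
  moves exactly \<open>l\<close> further away from \<open>s\<close>.\<close>

lemma level_set_dist:
  assumes a: "a \<in> level_set n S l" and s: "s \<in> S"
  shows "card (dif a s) + l \<le> d"
proof -
  have aS: "a \<in> S" and ball: "hball n a l \<subseteq> S" using a by (auto simp: level_set_def)
  have fin: "finite (dif a s)" using diam aS s by blast
  then obtain W where W: "W \<subseteq> - dif a s" "finite W" "card W = l"
    by (metis infinite_arbitrarily_large finite_compl infinite_UNIV_nat)
  define y where "y = (\<lambda>i. if i \<in> W then (if a i = 1 then 2 else 1) else a i)"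
  have yW: "dif a y = W" by (auto simp: dif_def y_def)
  have "y \<in> seqs n" using aS S_seqs two_le by (auto simp: seqs_iff y_def)
  then have "y \<in> S" using ball W yW by (auto simp: hball_def hdist_le_iff)
  then have "card (dif y s) \<le> d" using diam s by blast
  moreover have "dif y s = dif a s \<union> W"
    using W(1) by (auto simp: dif_def y_def)
  ultimately show ?thesis using W fin
    by (metis card_Un_disjoint disjoint_eq_subset_Compl inf_commute)
qed

text \<open>Otherwise one step from \<open>a\<close> towards \<open>b\<close> reaches a centre whose
  ball of radius \<open>l + 1\<close> lies in \<open>S\<close> and swallows the
  \<open>l\<close>-ball around \<open>a\<close>, which the level set forbids.\<close>

lemma level_set_far:
  assumes a: "a \<in> level_set n S l" and b: "b \<in> seqs n"
    and fin: "finite (dif a b)" and pos: "dif a b \<noteq> {}"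
  shows "\<exists>s\<in>S. d < card (dif b s) + l + card (dif a b)"
proof (rule ccontr)
  assume "\<not> ?thesis"
  then have near: "card (dif b s) + l + card (dif a b) \<le> d" if "s \<in> S" for s
    using that by (meson not_le)
  have aS: "a \<in> S" using a by (auto simp: level_set_def)
  obtain i where i: "i \<in> dif a b" using pos by blast
  define b' where "b' = a(i := b i)"
  have b': "b' \<in> seqs n" using aS S_seqs b by (auto simp: seqs_iff b'_def)
  have ab': "dif a b' = {i}" using i by (auto simp: dif_def b'_def)
  have b'b: "dif b' b = dif a b - {i}" by (auto simp: dif_def b'_def)
  have finb: "finite (dif b s)" if "s \<in> S" for s
    using that fin diam [OF aS that] finite_dif_trans [of b a s] dif_commute by metis
  have "hball n b' (l + 1) \<subseteq> S"
  proof (rule ball_subset)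
    fix s assume s: "s \<in> S"
    have "card (dif b' b) + 1 = card (dif a b)"
      unfolding b'b using fin i by (metis Suc_eq_plus1 card.remove)
    moreover have "finite (dif b' b)" unfolding b'b using fin by simp
    ultimately show "finite (dif b' s) \<and> card (dif b' s) + (l + 1) \<le> d"
      using near [OF s] finb [OF s] finite_dif_trans [of b' b s] card_dif_triangle [of b' b s]
      by linarith
  qed
  moreover have "hball n a l \<subseteq> hball n b' (l + 1)"
  proof
    fix y assume "y \<in> hball n a l"
    then show "y \<in> hball n b' (l + 1)"
      using finite_dif_trans [of b' a y] card_dif_triangle [of b' a y] ab' dif_commute [of b' a]
      by (auto simp: hball_def hdist_le_iff)
  qed
  ultimately show False using a b' by (auto simp: level_set_def)
qed

text \<open>A far element \<open>s\<close> confines at least one difference from \<open>b\<close> to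
  the known set \<open>dif b s\<close>. Guessing that place and its symbol brings \<open>b\<close>
  one step closer, so each round costs at most \<open>(d + k) * n\<close>.\<close>

lemma card_level_set_sphere:
  assumes "b \<in> seqs n"
  shows "finite {a \<in> level_set n S l. finite (dif a b) \<and> card (dif a b) = k} \<and>
         card {a \<in> level_set n S l. finite (dif a b) \<and> card (dif a b) = k} \<le> ((d + k) * n) ^ k"
  using assms
proof (induction k arbitrary: b)
  case 0
  have sub: "{a \<in> level_set n S l. finite (dif a b) \<and> card (dif a b) = 0} \<subseteq> {b}"
    by (auto simp: dif_def)
  show ?case
    using card_mono [OF _ sub] finite_subset [OF sub] by simp
next
  case (Suc k)
  let ?X = "\<lambda>k b. {a \<in> level_set n S l. finite (dif a b) \<and> card (dif a b) = k}"
  show ?case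
  proof (cases "?X (Suc k) b = {}")
    case True
    then show ?thesis by (simp only: finite.emptyI card.empty) simp
  next
    case False
    then obtain a0 where a0: "a0 \<in> level_set n S l" "finite (dif a0 b)" "card (dif a0 b) = Suc k"
      by auto
    then have "dif a0 b \<noteq> {}" by auto
    \<comment> \<open>Although found through \<open>a0\<close>, this \<open>s\<close> serves the
      whole sphere: the inequality involves only \<open>l\<close> and the common distance
      \<open>Suc k\<close>.\<close>
    then obtain s where s: "s \<in> S" "d < card (dif b s) + l + Suc k"
      using level_set_far [OF a0(1) Suc.prems a0(2)] a0(3) by auto
    have a0S: "a0 \<in> S" using a0(1) by (auto simp: level_set_def)
    have finB: "finite (dif b s)"
      using diam [OF a0S s(1)] a0(2) finite_dif_trans [of b a0 s] by (simp add: dif_commute [of b a0])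
    have cardB: "card (dif b s) \<le> d + Suc k"
      using diam [OF a0S s(1)] a0 card_dif_triangle [of b a0 s] by (simp add: dif_commute [of b a0])
    let ?P = "dif b s \<times> {1..n}"
    have sub: "?X (Suc k) b \<subseteq> (\<Union>p\<in>?P. ?X k (b(fst p := snd p)))"
    proof
      fix a assume "a \<in> ?X (Suc k) b"
      then have a: "a \<in> level_set n S l" "finite (dif a b)" "card (dif a b) = Suc k" by auto
      \<comment> \<open>If \<open>dif a b\<close> and \<open>dif b s\<close> were disjoint,
        \<open>card (dif a s) + l\<close> would exceed \<open>d\<close>.\<close>
      have "card (dif b s) + card (dif a b) \<le> card (dif a s) + 2 * card (dif a b \<inter> dif b s)"
        using card_dif_ge a(2) finB by blast
      then have "card (dif a b \<inter> dif b s) \<noteq> 0"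
        using level_set_dist [OF a(1) s(1)] s(2) a(3) by linarith
      then have "dif a b \<inter> dif b s \<noteq> {}" by (metis card.empty)
      then obtain j where j: "j \<in> dif a b" "j \<in> dif b s" by blast
      have "dif a (b(j := a j)) = dif a b - {j}" by (auto simp: dif_def)
      then have "a \<in> ?X k (b(j := a j))" using a j by auto
      moreover have "a \<in> seqs n" using a(1) S_seqs by (auto simp: level_set_def)
      then have "a j \<in> {1..n}" by (simp add: seqs_iff del: atLeastAtMost_iff)
      ultimately show "a \<in> (\<Union>p\<in>?P. ?X k (b(fst p := snd p)))"
        using j(2) by (intro UN_I [of "(j, a j)"]) auto
    qed
    have finP: "finite ?P" using finB by auto
    have IH: "finite (?X k (b(fst p := snd p)))"
      "card (?X k (b(fst p := snd p))) \<le> ((d + k) * n) ^ k" if "p \<in> ?P" for p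
    proof -
      have "b(fst p := snd p) \<in> seqs n" using Suc.prems that by (auto simp: seqs_iff)
      then show "finite (?X k (b(fst p := snd p)))"
        "card (?X k (b(fst p := snd p))) \<le> ((d + k) * n) ^ k" using Suc.IH by blast+
    qed
    have finU: "finite (\<Union>p\<in>?P. ?X k (b(fst p := snd p)))"
      using finP IH(1) by blast
    have "card (?X (Suc k) b) \<le> card (\<Union>p\<in>?P. ?X k (b(fst p := snd p)))"
      using card_mono finU sub by blast
    also have "\<dots> \<le> (\<Sum>p\<in>?P. card (?X k (b(fst p := snd p))))"
      using card_UN_le finP by blast
    also have "\<dots> \<le> (\<Sum>p\<in>?P. ((d + k) * n) ^ k)"
      using IH(2) by (intro sum_mono)
    also have "\<dots> = (card (dif b s) * n) * ((d + k) * n) ^ k"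
      by (simp add: card_cartesian_product)
    also have "\<dots> \<le> ((d + Suc k) * n) * ((d + Suc k) * n) ^ k"
      using cardB by (intro mult_mono power_mono) auto
    finally show ?thesis
      using finite_subset [OF sub finU] by simp
  qed
qed

section \<open>Counting by successive revelation of coordinates\<close>

definition agreeing :: "nat \<Rightarrow> nat set \<Rightarrow> (nat \<Rightarrow> nat) \<Rightarrow> nat \<Rightarrow> (nat \<Rightarrow> nat) set" where
  "agreeing l U b k =
     {a \<in> level_set n S l. (\<forall>i\<in>U. a i = b i) \<and> finite (dif a b) \<and> card (dif a b) = k}"

text \<open>\<open>U\<close> holds the coordinates already revealed and \<open>b\<close> is the
  current approximation. Revealing \<open>a\<close> on \<open>E\<close> removes exactly the
  differences inside \<open>E\<close>; their number depends on \<open>g\<close> and \<open>b\<close>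
  alone, so branches can be indexed by \<open>g\<close>.\<close>

lemma agreeing_branch:
  fixes E :: "nat set"
  assumes a: "a \<in> agreeing l U b k"
  defines "g \<equiv> restrict a E"
  shows "g \<in> E \<rightarrow>\<^sub>E {1..n}"
    and "dif a b \<inter> E = {j \<in> E. g j \<noteq> b j}"
    and "card {j \<in> E. g j \<noteq> b j} \<le> k"
    and "a \<in> agreeing l (U \<union> E) (override_on b g E) (k - card {j \<in> E. g j \<noteq> b j})"
proof -
  have a': "a \<in> level_set n S l" "\<forall>i\<in>U. a i = b i" "finite (dif a b)" "card (dif a b) = k"
    using a by (auto simp: agreeing_def)
  have "\<forall>i. a i \<in> {1..n}" using a'(1) S_seqs by (auto simp: level_set_def seqs_iff)
  then show "g \<in> E \<rightarrow>\<^sub>E {1..n}" by (auto simp: g_def)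
  show eq: "dif a b \<inter> E = {j \<in> E. g j \<noteq> b j}" by (auto simp: dif_def g_def)
  have "dif a (override_on b g E) = dif a b - dif a b \<inter> E"
    by (auto simp: dif_def g_def override_on_def)
  moreover have "card (dif a b - dif a b \<inter> E) = k - card (dif a b \<inter> E)"
    using a'(3,4) by (subst card_Diff_subset) auto
  ultimately show "a \<in> agreeing l (U \<union> E) (override_on b g E) (k - card {j \<in> E. g j \<noteq> b j})"
    using a' unfolding agreeing_def eq by (auto simp: override_on_def g_def)
  show "card {j \<in> E. g j \<noteq> b j} \<le> k"
    using a'(3,4) by (auto simp flip: eq intro!: card_mono)
qed

text \<open>Each step of the induction halves the excess \<open>k - L\<close>; the factor \<open>max 1 (2 * (k - L)) ^ L\<close>
  collects one factor \<open>2 ^ L\<close> per step. Halving \<open>\<delta>\<close> as well keeps the accumulated factor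
  \<open>exp (\<delta> * d)\<close> bounded.\<close>

lemma card_agreeing:
  fixes \<delta> :: real
  assumes no_ball: "\<And>b. b \<in> seqs n \<Longrightarrow> \<not> hball n b (L + 1) \<subseteq> S"
    and D: "\<And>s. s \<in> S \<Longrightarrow> finite (dif x s) \<and> 2 * card (dif x s - D) \<le> d"
    and "D \<subseteq> U" "b \<in> seqs n" "\<And>i. i \<notin> U \<Longrightarrow> b i = x i" "0 < \<delta>" "\<delta> \<le> 1"
  shows "finite (agreeing l U b k) \<and>
    real (card (agreeing l U b k))
      \<le> (real ((d + L) * n) * real (max 1 (2 * (k - L)))) ^ L * (2 * n / \<delta>) ^ k * exp (\<delta> * d)"
  using assms(3-7)
proof (induction k arbitrary: U b \<delta> rule: less_induct)
  case (less k)
  let ?K = "real ((d + L) * n)"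
  have ratio: "1 \<le> 2 * real n / \<delta>" using less.prems(4,5) two_le by (simp add: field_simps)
  have e1: "1 \<le> exp (\<delta> * d)" using less.prems(4) by simp
  show ?case
  proof (cases "k \<le> L")
    case True
    let ?Y = "{a \<in> level_set n S l. finite (dif a b) \<and> card (dif a b) = k}"
    have sub: "agreeing l U b k \<subseteq> ?Y" by (auto simp: agreeing_def)
    have Y: "finite ?Y" "card ?Y \<le> ((d + k) * n) ^ k"
      using card_level_set_sphere [OF less.prems(2)] by blast+
    have fin: "finite (agreeing l U b k)" using sub Y(1) by (rule finite_subset)
    have "card (agreeing l U b k) \<le> ((d + k) * n) ^ k"
      using card_mono [OF Y(1) sub] Y(2) by linarith
    also have "\<dots> \<le> ((d + L) * n) ^ L"
    proof (cases "L = 0")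
      case False
      have "((d + k) * n) ^ k \<le> ((d + L) * n) ^ k" using True by (intro power_mono) auto
      also have "\<dots> \<le> ((d + L) * n) ^ L"
        using True False two_le by (intro power_increasing) auto
      finally show ?thesis .
    qed (use True in auto)
    finally have "real (card (agreeing l U b k)) \<le> real (((d + L) * n) ^ L)" by linarith
    also have "\<dots> = ?K ^ L * 1 * 1" by simp
    also have "\<dots> \<le> ?K ^ L * (2 * n / \<delta>) ^ k * exp (\<delta> * d)"
      using ratio e1 by (intro mult_mono one_le_power mult_nonneg_nonneg) auto
    finally show ?thesis using fin True by simp
  next
    case False
    then have kL: "L < k" by simp
    show ?thesis
    proof (cases "agreeing l U b k = {}")
      case True
      then show ?thesis using less.prems(4) by simp
    next
      case False
      then obtain a0 where a0: "a0 \<in> agreeing l U b k" by blast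
      have a0S: "a0 \<in> S" and a0b: "finite (dif b a0)"
        using a0 by (auto simp: agreeing_def level_set_def dif_commute)
      have finb: "finite (dif b s)" if "s \<in> S" for s
        using finite_dif_trans [OF a0b] diam [OF a0S that] by blast
      obtain s where s: "s \<in> S" "d < card (dif b s) + (L + 1)"
        using no_ball [OF less.prems(2)] ball_subset [of b "L + 1"] finb not_le by metis
      \<comment> \<open>Only unrevealed coordinates are new. There \<open>b\<close> still equals
        \<open>x\<close>, so \<open>E\<close> inherits the bound \<open>d / 2\<close> from the
        hypothesis on \<open>D\<close>.\<close>
      define E where "E = dif b s - U"
      have E_x: "E \<subseteq> dif x s - D"
        using less.prems(1,3) by (auto simp: E_def dif_def)
      have finE: "finite E" using finb [OF s(1)] by (simp add: E_def)
      have "finite (dif x s - D)" using D [OF s(1)] by blast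
      then have cardE: "2 * card E \<le> d"
        using D [OF s(1)] card_mono [OF _ E_x] by linarith
      let ?c = "\<lambda>g. card {j \<in> E. g j \<noteq> b j}"
      \<comment> \<open>The second condition says that at least half of the excess
        \<open>k - L\<close> is corrected on \<open>E\<close>; \<open>card_dif_ge\<close> and the
        choice of \<open>s\<close> force it on every branch that occurs.\<close>
      let ?G = "{g \<in> E \<rightarrow>\<^sub>E {1..n}. ?c g \<le> k \<and> k \<le> L + 2 * ?c g}"
      let ?X = "\<lambda>g. agreeing l (U \<union> E) (override_on b g E) (k - ?c g)"
      have finPi: "finite (E \<rightarrow>\<^sub>E {1..n})" using finE by (simp add: finite_PiE)
      have finG: "finite ?G" using finPi by simp
      have sub: "agreeing l U b k \<subseteq> (\<Union>g\<in>?G. ?X g)"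
      proof
        fix a assume a: "a \<in> agreeing l U b k"
        have a': "a \<in> S" "\<forall>i\<in>U. a i = b i" "finite (dif a b)" "card (dif a b) = k"
          using a by (auto simp: agreeing_def level_set_def)
        have "dif a b \<inter> dif b s = dif a b \<inter> E"
          using a'(2) by (auto simp: dif_def E_def)
        then have "k \<le> L + 2 * card (dif a b \<inter> E)"
          using card_dif_ge [OF a'(3) finb [OF s(1)]] s(2) diam [OF a'(1) s(1)] a'(4) by auto
        then show "a \<in> (\<Union>g\<in>?G. ?X g)"
          using agreeing_branch [OF a, of E] by (intro UN_I [of "restrict a E"]) auto
      qed
      \<comment> \<open>The target bound with only half of the exponent \<open>\<delta> * d\<close>;
        the other half pays for the sum over \<open>g\<close>.\<close>
      define M where "M = (?K * real (max 1 (2 * (k - L)))) ^ L * (2 * n / \<delta>) ^ k * exp (\<delta> / 2 * d)"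
      have M0: "0 \<le> M" using less.prems(4) by (simp add: M_def)
      have IH: "finite (?X g)" "real (card (?X g)) \<le> M * (\<delta> / n) ^ ?c g" if g: "g \<in> ?G" for g
      proof -
        define c where "c = ?c g"
        have c: "c \<le> k" "k \<le> L + 2 * c" using g by (auto simp: c_def)
        then have "k - c < k" using kL by linarith
        moreover have "override_on b g E \<in> seqs n"
          using g less.prems(2) by (auto simp: seqs_iff override_on_def)
        ultimately have *: "finite (?X g) \<and> real (card (?X g))
            \<le> (?K * real (max 1 (2 * (k - c - L)))) ^ L * (2 * n / (\<delta> / 2)) ^ (k - c) * exp (\<delta> / 2 * d)"
          unfolding c_def [symmetric]
          using less.prems by (intro less.IH) (auto simp: override_on_def)
        then show "finite (?X g)" by blast
        have "2 * max 1 (2 * (k - c - L)) \<le> max 1 (2 * (k - L))"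
          using c kL by auto
        then have le: "2 * real (max 1 (2 * (k - c - L))) \<le> real (max 1 (2 * (k - L)))"
          by linarith
        \<comment> \<open>Halving \<open>\<delta>\<close> costs a factor 2 for each of the
          \<open>k - c\<close> remaining differences. Of these at most \<open>L + c\<close> twos,
          \<open>2 ^ L\<close> is absorbed by the halved excess and \<open>2 ^ c\<close> by the
          weight \<open>(\<delta> / n) ^ c\<close>.\<close>
        have pw2: "(2::real) ^ (k - c) \<le> 2 ^ (L + c)"
          using c by (intro power_increasing) auto
        have pw: "(2 * n / (\<delta> / 2)) ^ (k - c) \<le> 2 ^ L * 2 ^ c * (2 * n / \<delta>) ^ (k - c)"
        proof -
          have "(2 * n / (\<delta> / 2)) ^ (k - c) = 2 ^ (k - c) * (2 * n / \<delta>) ^ (k - c)"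
            by (simp flip: power_mult_distrib)
          also have "\<dots> \<le> 2 ^ (L + c) * (2 * n / \<delta>) ^ (k - c)"
            using pw2 ratio by (intro mult_right_mono) auto
          finally show ?thesis by (simp add: power_add)
        qed
        have "(2 * real n / \<delta>) ^ k = (2 * n / \<delta>) ^ (k - c) * (2 * n / \<delta>) ^ c"
          using c by (simp flip: power_add)
        then have sp: "2 ^ c * (2 * n / \<delta>) ^ (k - c) = (2 * n / \<delta>) ^ k * (\<delta> / n) ^ c"
          using less.prems(4) two_le by (simp add: power_divide power_mult_distrib field_simps)
        have "real (card (?X g))
            \<le> (?K * real (max 1 (2 * (k - c - L)))) ^ L * (2 * n / (\<delta> / 2)) ^ (k - c) * exp (\<delta> / 2 * d)"
          using * by blast
        also have "\<dots> \<le> (?K * real (max 1 (2 * (k - c - L)))) ^ L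
              * (2 ^ L * 2 ^ c * (2 * n / \<delta>) ^ (k - c)) * exp (\<delta> / 2 * d)"
          using pw by (intro mult_right_mono mult_left_mono) auto
        also have "\<dots> = (?K * (2 * real (max 1 (2 * (k - c - L))))) ^ L
              * (2 ^ c * (2 * n / \<delta>) ^ (k - c)) * exp (\<delta> / 2 * d)"
          by (simp add: power_mult_distrib)
        also have "\<dots> \<le> (?K * real (max 1 (2 * (k - L)))) ^ L
              * (2 ^ c * (2 * n / \<delta>) ^ (k - c)) * exp (\<delta> / 2 * d)"
          using le ratio by (intro mult_right_mono power_mono mult_left_mono) auto
        also have "\<dots> = M * (\<delta> / n) ^ c" unfolding sp M_def by simp
        finally show "real (card (?X g)) \<le> M * (\<delta> / n) ^ ?c g" by (simp add: c_def)
      qed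
      have finU: "finite (\<Union>g\<in>?G. ?X g)" using finG IH(1) by blast
      have "card (agreeing l U b k) \<le> card (\<Union>g\<in>?G. ?X g)"
        using card_mono finU sub by blast
      also have "\<dots> \<le> (\<Sum>g\<in>?G. card (?X g))"
        using card_UN_le finG by blast
      finally have "real (card (agreeing l U b k)) \<le> (\<Sum>g\<in>?G. real (card (?X g)))"
        by (simp flip: of_nat_sum)
      also have "\<dots> \<le> (\<Sum>g\<in>?G. M * (\<delta> / n) ^ ?c g)"
        using IH(2) by (intro sum_mono)
      \<comment> \<open>Dropping the conditions on \<open>g\<close> leaves a full product space,
        over which the sum factors coordinatewise.\<close>
      also have "\<dots> \<le> (\<Sum>g\<in>E \<rightarrow>\<^sub>E {1..n}. M * (\<delta> / n) ^ ?c g)"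
        using finPi M0 less.prems(4) by (intro sum_mono2) auto
      also have "\<dots> = M * (\<Sum>g\<in>E \<rightarrow>\<^sub>E {1..n}. \<Prod>j\<in>E. if g j \<noteq> b j then \<delta> / n else 1)"
        using finE by (simp add: sum_distrib_left power_card_filter)
      also have "\<dots> = M * (\<Prod>j\<in>E. \<Sum>v\<in>{1..n}. if v \<noteq> b j then \<delta> / n else 1)"
        using finE by (subst prod_sum_PiE) auto
      also have "\<dots> \<le> M * (\<Prod>j\<in>E. exp \<delta>)"
      proof (intro mult_left_mono [OF _ M0] prod_mono conjI)
        fix j assume "j \<in> E"
        show "0 \<le> (\<Sum>v\<in>{1..n}. if v \<noteq> b j then \<delta> / n else 1)"
          using less.prems(4) by (intro sum_nonneg) auto
        \<comment> \<open>Keeping the symbol \<open>b j\<close> weighs 1, and the other symbols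
          weigh at most \<open>\<delta>\<close> together.\<close>
        have "(\<Sum>v\<in>{1..n}. if v \<noteq> b j then \<delta> / n else 1)
            \<le> (\<Sum>v\<in>{1..n}. \<delta> / n + (if v = b j then 1 else 0))"
          using less.prems(4) by (intro sum_mono) auto
        also have "\<dots> \<le> 1 + \<delta>" using two_le by (simp add: sum.distrib)
        also have "\<dots> \<le> exp \<delta>" by simp
        finally show "(\<Sum>v\<in>{1..n}. if v \<noteq> b j then \<delta> / n else 1) \<le> exp \<delta>" .
      qed
      also have "\<dots> = M * exp (\<delta> * card E)"
        by (simp add: exp_of_nat2_mult)
      also have "\<dots> \<le> M * exp (\<delta> / 2 * d)"
        using cardE less.prems(4) M0
        by (intro mult_left_mono) (auto simp flip: of_nat_mult intro!: mult_left_mono)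
      also have "\<dots> = (?K * real (max 1 (2 * (k - L)))) ^ L * (2 * n / \<delta>) ^ k * exp (\<delta> * d)"
        by (simp add: M_def flip: exp_add)
      finally show ?thesis using finite_subset [OF sub finU] by simp
    qed
  qed
qed

section \<open>Revealing the block where a diametral pair differs\<close>

lemma level_set_cover:
  assumes x: "x \<in> S" and s: "s \<in> S" and d: "card (dif x s) = d"
    and a: "a \<in> level_set n S l"
  defines "D \<equiv> dif x s"
  shows "\<exists>g \<in> D \<rightarrow>\<^sub>E {1..n}. \<exists>k\<le>d. a \<in> agreeing l D (override_on x g D) k \<and>
    2 * k \<le> card {j \<in> D. g j = x j} + card {j \<in> D. g j = s j}"
proof -
  have aS: "a \<in> S" using a by (auto simp: level_set_def)
  have finD: "finite D" using diam [OF x s] by (simp add: D_def)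
  define g where "g = restrict a D"
  \<comment> \<open>As \<open>card D = d\<close> bounds the distance from \<open>a\<close> to
    \<open>y\<close>, each difference outside \<open>D\<close> is paid for by an agreement on
    \<open>D\<close>.\<close>
  have k: "card (dif a y - D) \<le> card {j \<in> D. g j = y j}" if y: "y \<in> S" for y
  proof -
    have fin: "finite (dif a y)" and le: "card (dif a y) \<le> d" using diam [OF aS y] by auto
    have "card (dif a y) = card (dif a y \<inter> D) + card (dif a y - D)"
      using fin by (subst card_Un_disjoint [symmetric]) (auto intro: arg_cong [where f = card])
    moreover have "card D = card (dif a y \<inter> D) + card {j \<in> D. g j = y j}"
      using finD fin
      by (subst card_Un_disjoint [symmetric]) (auto simp: dif_def g_def intro!: arg_cong [where f = card])
    ultimately show ?thesis using le d by (simp add: D_def)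
  qed
  \<comment> \<open>Off \<open>D\<close> the sequences \<open>x\<close> and \<open>s\<close>
    coincide, so the same differences are paid for twice; hence the factor 2 before
    \<open>k\<close>.\<close>
  have same: "dif a x - D = dif a s - D" by (auto simp: D_def dif_def)
  have fin: "finite (dif a x)" using diam [OF aS x] by blast
  have "a \<in> agreeing l {} x (card (dif a x))" using a fin by (simp add: agreeing_def)
  from agreeing_branch [OF this, of D]
  have g: "g \<in> D \<rightarrow>\<^sub>E {1..n}"
    and ag: "a \<in> agreeing l D (override_on x g D) (card (dif a x) - card (dif a x \<inter> D))"
    by (auto simp: g_def)
  have eq: "card (dif a x) - card (dif a x \<inter> D) = card (dif a x - D)"
    using fin by (simp add: card_Diff_subset_Int)
  have "card {j \<in> D. g j = x j} \<le> card D" using finD by (intro card_mono) auto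
  then have "card (dif a x - D) \<le> d" using k [OF x] d unfolding D_def by linarith
  moreover have "2 * card (dif a x - D) \<le> card {j \<in> D. g j = x j} + card {j \<in> D. g j = s j}"
    using k [OF x] k [OF s] same by simp
  moreover have "a \<in> agreeing l D (override_on x g D) (card (dif a x - D))"
    using ag by (simp only: eq)
  ultimately show ?thesis using g by blast
qed

text \<open>On \<open>dif x s\<close>, each coordinate of \<open>t\<close> differs from
  \<open>x\<close> or from \<open>s\<close>, which uses up at least \<open>d\<close> of the at most
  \<open>2 * d\<close> differences. Those outside count for both \<open>x\<close> and
  \<open>s\<close>. This supplies the hypothesis on \<open>D\<close> in
  \<open>card_agreeing\<close>.\<close>

lemma card_dif_outside:
  assumes "x \<in> S" "s \<in> S" "card (dif x s) = d" "t \<in> S"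
  shows "2 * card (dif x t - dif x s) \<le> d"
proof -
  let ?D = "dif x s"
  have split: "card (dif y t) = card (dif y t \<inter> ?D) + card (dif y t - ?D)" if "y \<in> S" for y
    using diam [OF that assms(4)]
    by (subst card_Un_disjoint [symmetric]) (auto intro: arg_cong [where f = card])
  have "card ?D \<le> card ((dif x t \<inter> ?D) \<union> (dif s t \<inter> ?D))"
    using diam assms by (intro card_mono) (auto simp: dif_def)
  also have "\<dots> \<le> card (dif x t \<inter> ?D) + card (dif s t \<inter> ?D)"
    by (rule card_Un_le)
  finally have "d \<le> card (dif x t \<inter> ?D) + card (dif s t \<inter> ?D)" using assms by simp
  moreover have "dif x t - ?D = dif s t - ?D" by (auto simp: dif_def)
  ultimately show ?thesis
    using split [OF assms(1)] split [OF assms(2)] diam [OF assms(1,4)] diam [OF assms(2,4)]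
    by simp
qed

text \<open>One difference outside \<open>D\<close> costs
  \<open>2 * n / \<delta> = w\<^sup>2\<close> and is matched by two agreements on \<open>D\<close>,
  so each agreement is charged \<open>w\<close>. The sum over \<open>g\<close> then factors, with at
  most \<open>n + 2 * w\<close> per coordinate; \<open>d + 1\<close> counts the values of
  \<open>k\<close>.\<close>

lemma card_level_set:
  fixes \<delta> w :: real
  assumes no_ball: "\<And>b. b \<in> seqs n \<Longrightarrow> \<not> hball n b (L + 1) \<subseteq> S"
    and x: "x \<in> S" and s: "s \<in> S" and d: "card (dif x s) = d" "1 \<le> d"
    and \<delta>: "0 < \<delta>" "\<delta> \<le> 1" and w: "1 \<le> w" "w\<^sup>2 = 2 * n / \<delta>"
  shows "finite (level_set n S l) \<and>
    real (card (level_set n S l))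
      \<le> (d + 1) * (real ((d + L) * n) * (2 * d)) ^ L * exp (\<delta> * d) * (n + 2 * w) ^ d"
proof -
  define D where "D = dif x s"
  have finD: "finite D" using diam [OF x s] by (simp add: D_def)
  define m where "m g = card {j \<in> D. g j = x j} + card {j \<in> D. g j = s j}" for g
  let ?P = "D \<rightarrow>\<^sub>E {1..n}"
  let ?I = "{p \<in> ?P \<times> {..d}. 2 * snd p \<le> m (fst p)}"
  let ?X = "\<lambda>p. agreeing l D (override_on x (fst p) D) (snd p)"
  define N where "N = (real ((d + L) * n) * (2 * d)) ^ L * exp (\<delta> * d)"
  have finP: "finite ?P" using finD by (simp add: finite_PiE)
  then have finI: "finite ?I" by simp
  have sub: "level_set n S l \<subseteq> (\<Union>p\<in>?I. ?X p)"
  proof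
    fix a assume a: "a \<in> level_set n S l"
    obtain g k where "g \<in> ?P" "k \<le> d" "a \<in> ?X (g, k)" "2 * k \<le> m g"
      using level_set_cover [OF x s d(1) a] unfolding D_def m_def fst_conv snd_conv by blast
    then show "a \<in> (\<Union>p\<in>?I. ?X p)" by (intro UN_I [of "(g, k)"]) auto
  qed
  have X: "finite (?X p)" "real (card (?X p)) \<le> N * w ^ m (fst p)" if p: "p \<in> ?I" for p
  proof -
    obtain g k where gk: "p = (g, k)" "g \<in> ?P" "k \<le> d" "2 * k \<le> m g" using p by auto
    have "override_on x g D \<in> seqs n"
      using gk(2) x S_seqs by (auto simp: seqs_iff override_on_def)
    then have *: "finite (?X p) \<and> real (card (?X p))
        \<le> (real ((d + L) * n) * real (max 1 (2 * (k - L)))) ^ L * (2 * n / \<delta>) ^ k * exp (\<delta> * d)"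
      unfolding gk fst_conv snd_conv
      using card_dif_outside [OF x s d(1)] diam [OF x] no_ball \<delta>
      by (intro card_agreeing [where x = x and D = D]) (auto simp: D_def override_on_def)
    then show "finite (?X p)" by blast
    have "real (card (?X p))
        \<le> (real ((d + L) * n) * real (max 1 (2 * (k - L)))) ^ L * (2 * n / \<delta>) ^ k * exp (\<delta> * d)"
      using * by blast
    also have "\<dots> \<le> (real ((d + L) * n) * (2 * d)) ^ L * w ^ m g * exp (\<delta> * d)"
    proof (intro mult_right_mono mult_mono power_mono mult_left_mono)
      have "max 1 (2 * (k - L)) \<le> 2 * d" using gk(3) d(2) by auto
      then show "real (max 1 (2 * (k - L))) \<le> real (2 * d)" by linarith
      have "(2 * n / \<delta>) ^ k = w ^ (2 * k)" by (simp add: power_mult w(2))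
      also have "\<dots> \<le> w ^ m g" using gk(4) w(1) by (intro power_increasing) auto
      finally show "(2 * n / \<delta>) ^ k \<le> w ^ m g" .
    qed (use \<delta> w in auto)
    finally show "real (card (?X p)) \<le> N * w ^ m (fst p)"
      by (simp add: N_def gk mult_ac)
  qed
  have N0: "0 \<le> N" by (simp add: N_def)
  have finU: "finite (\<Union>p\<in>?I. ?X p)" using finI X(1) by blast
  have "card (level_set n S l) \<le> card (\<Union>p\<in>?I. ?X p)"
    using card_mono finU sub by blast
  also have "\<dots> \<le> (\<Sum>p\<in>?I. card (?X p))" using card_UN_le finI by blast
  finally have "real (card (level_set n S l)) \<le> (\<Sum>p\<in>?I. real (card (?X p)))"
    by (simp flip: of_nat_sum)
  also have "\<dots> \<le> (\<Sum>p\<in>?I. N * w ^ m (fst p))" using X(2) by (intro sum_mono)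
  also have "\<dots> \<le> (\<Sum>p\<in>?P \<times> {..d}. N * w ^ m (fst p))"
    using finP N0 w(1) by (intro sum_mono2) auto
  also have "\<dots> = (d + 1) * N * (\<Sum>g\<in>?P. w ^ m g)"
    by (simp add: sum.cartesian_product' sum_distrib_left mult_ac)
  also have "(\<Sum>g\<in>?P. w ^ m g) =
      (\<Sum>g\<in>?P. \<Prod>j\<in>D. (if g j = x j then w else 1) * (if g j = s j then w else 1))"
    using finD by (simp add: m_def power_add power_card_filter prod.distrib)
  also have "\<dots> = (\<Prod>j\<in>D. \<Sum>v\<in>{1..n}. (if v = x j then w else 1) * (if v = s j then w else 1))"
    using finD by (subst prod_sum_PiE) auto
  also have "\<dots> \<le> (\<Prod>j\<in>D. n + 2 * w)"
  proof (intro prod_mono conjI)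
    fix j assume "j \<in> D"
    then have j: "x j \<noteq> s j" by (simp add: D_def dif_def)
    show "0 \<le> (\<Sum>v\<in>{1..n}. (if v = x j then w else 1) * (if v = s j then w else 1))"
      using w(1) by (intro sum_nonneg) auto
    \<comment> \<open>Since \<open>x j\<close> and \<open>s j\<close> are distinct, no symbol
      collects \<open>w\<close> twice.\<close>
    have "(\<Sum>v\<in>{1..n}. (if v = x j then w else 1) * (if v = s j then w else 1))
        \<le> (\<Sum>v\<in>{1..n}. 1 + (if v = x j then w else 0) + (if v = s j then w else 0))"
      using w(1) j by (intro sum_mono) auto
    also have "\<dots> \<le> n + 2 * w" using w(1) by (simp add: sum.distrib)
    finally show "(\<Sum>v\<in>{1..n}. (if v = x j then w else 1) * (if v = s j then w else 1))
        \<le> n + 2 * w" .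
  qed
  also have "\<dots> = (n + 2 * w) ^ d" using d(1) by (simp add: D_def)
  finally have "real (card (level_set n S l)) \<le> (d + 1) * N * (n + 2 * w) ^ d"
    using N0 by (simp add: mult_left_mono)
  then show ?thesis using finite_subset [OF sub finU] by (simp add: N_def mult_ac)
qed

end

section \<open>Reduction to the locale and choice of constants\<close>

lemma maximal_diam_imp_locale:
  assumes S: "maximal_diam n d S" and "1 \<le> d"
  shows "max_diam_set n d S \<and> (\<exists>x\<in>S. \<exists>s\<in>S. card (dif x s) = d)"
proof -
  have sub: "S \<subseteq> seqs n" and hd: "hdiam S = enat d"
    and mx: "\<And>T. T \<subseteq> seqs n \<Longrightarrow> hdiam T = enat d \<Longrightarrow> S \<subseteq> T \<Longrightarrow> T = S"
    using S by (auto simp: maximal_diam_def)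
  have hdist_le: "hdist a b \<le> hdiam S" if "a \<in> S" "b \<in> S" for a b
    unfolding hdiam_def using that SUP_upper [of "(a, b)" "S \<times> S" "\<lambda>(a, b). hdist a b"] by simp
  have diam: "finite (dif a b) \<and> card (dif a b) \<le> d" if "a \<in> S" "b \<in> S" for a b
    using hdist_le [OF that] by (simp add: hd hdist_le_iff)
  have ex: "\<exists>x\<in>S. \<exists>s\<in>S. card (dif x s) = d"
  proof (rule ccontr)
    assume "\<not> ?thesis"
    \<comment> \<open>An unattained \<open>d\<close> would leave all distances, hence their
      supremum, at most \<open>d - 1\<close>.\<close>
    then have "hdist a b \<le> enat (d - 1)" if "a \<in> S" "b \<in> S" for a b
      using that diam [OF that] unfolding hdist_le_iff by fastforce
    then have "hdiam S \<le> enat (d - 1)"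
      unfolding hdiam_def by (intro SUP_least) auto
    then show False using hd \<open>1 \<le> d\<close> by simp
  qed
  then obtain x s where "x \<in> S" "s \<in> S" "dif x s \<noteq> {}" using \<open>1 \<le> d\<close> by fastforce
  then obtain i where "x i \<noteq> s i" "x i \<in> {1..n}" "s i \<in> {1..n}"
    using sub by (auto simp: dif_def seqs_iff subset_iff)
  then have two: "2 \<le> n" by auto
  have mx': "y \<in> S" if y: "y \<in> seqs n"
    and near: "\<And>s. s \<in> S \<Longrightarrow> finite (dif y s) \<and> card (dif y s) \<le> d" for y
  proof -
    \<comment> \<open>Inclusion-maximality only concerns sets of diameter exactly \<open>d\<close>,
      so both inequalities are required.\<close>
    have "hdiam (insert y S) = enat d"
    proof (rule antisym)
      have "hdist a b \<le> enat d" if "a \<in> insert y S" "b \<in> insert y S" for a b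
        using that near diam dif_commute [of _ y] unfolding hdist_le_iff by (auto simp: dif_def)
      then show "hdiam (insert y S) \<le> enat d"
        unfolding hdiam_def by (intro SUP_least) auto
      show "enat d \<le> hdiam (insert y S)"
        unfolding hd [symmetric] hdiam_def by (intro SUP_subset_mono) auto
    qed
    then have "insert y S = S" using mx y sub by blast
    then show ?thesis by blast
  qed
  have "max_diam_set n d S"
    by (rule max_diam_set.intro [OF sub diam mx' two])
  then show ?thesis using ex by blast
qed

text \<open>After multiplication by \<open>n\<close>, with \<open>t = n powr (-1/3)\<close>, this
  absorbs \<open>exp (\<delta> * d)\<close> into the base: the coefficient 4 of
  \<open>n powr (2/3)\<close> grows to 8.\<close>

lemma base_bound:
  fixes t :: real
  assumes "0 \<le> t" "t \<le> 1"
  shows "(1 + 4 * t) * exp (t / 2) \<le> 1 + 8 * t"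
proof -
  have tt: "t * t \<le> t" using mult_left_mono [OF assms(2,1)] by simp
  have "exp (t / 2) \<le> 1 + t / 2 + (t / 2)\<^sup>2" using assms by (intro exp_bound) auto
  also have "\<dots> \<le> 1 + 3 / 4 * t" using tt by (simp add: power2_eq_square)
  finally have "(1 + 4 * t) * exp (t / 2) \<le> (1 + 4 * t) * (1 + 3 / 4 * t)"
    using assms by (intro mult_left_mono) auto
  also have "\<dots> \<le> 1 + 8 * t" using tt assms by (simp add: algebra_simps)
  finally show ?thesis .
qed

theorem theorem4:
  fixes n L :: nat
  assumes "n \<ge> 1"
  shows "\<exists>C::real. \<forall>d\<ge>1. \<forall>S. \<forall>l::nat.
           maximal_diam n d S \<longrightarrow> \<not> contains_ball n (L + 1) S \<longrightarrow>
             finite (level_set n S l) \<and>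
             real (card (level_set n S l))
               \<le> C * real d ^ (2 * L + 2) * (real n + 8 * real n powr (2 / 3)) ^ d"
proof (intro exI allI impI)
  fix d l :: nat and S
  assume d: "1 \<le> d" and S: "maximal_diam n d S" and no_ball: "\<not> contains_ball n (L + 1) S"
  interpret max_diam_set n d S using maximal_diam_imp_locale [OF S d] by blast
  obtain x s where xs: "x \<in> S" "s \<in> S" "card (dif x s) = d"
    using maximal_diam_imp_locale [OF S d] by blast
  \<comment> \<open>Here \<open>\<delta> = t / 2\<close>, and
    \<open>w\<^sup>2 = 2 * n / \<delta>\<close> forces \<open>w = 2 * n powr (2/3)\<close>, so that
    \<open>n + 2 * w = n * (1 + 4 * t)\<close>.\<close>
  define t where "t = real n powr (- 1 / 3)"
  define w where "w = 2 * real n powr (2 / 3)"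
  have n1: "1 \<le> real n" using assms by simp
  have t: "0 < t" "t \<le> 1" using n1 powr_mono [of "- 1 / 3" 0 "real n"] by (auto simp: t_def)
  have w1: "1 \<le> w" using ge_one_powr_ge_zero [OF n1, of "2 / 3"] by (simp add: w_def)
  have nt: "n * t = real n powr (2 / 3)"
    using n1 powr_add [of "real n" 1 "- 1 / 3"] by (simp add: t_def)
  have "w\<^sup>2 * t = 4 * (real n powr (2 / 3) * real n powr (2 / 3) * real n powr (- 1 / 3))"
    by (simp add: w_def t_def power2_eq_square)
  also have "\<dots> = 4 * real n" using n1 by (simp flip: powr_add)
  finally have w2: "w\<^sup>2 = 2 * n / (t / 2)" using t by (simp add: field_simps)
  have bd: "finite (level_set n S l) \<and> real (card (level_set n S l))
      \<le> (d + 1) * (real ((d + L) * n) * (2 * d)) ^ L * exp (t / 2 * d) * (n + 2 * w) ^ d"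
    using no_ball t w1 w2 xs d by (intro card_level_set) (auto simp: contains_ball_def)
  \<comment> \<open>The factor \<open>d + 1\<close> is at most \<open>2 * d * d\<close> and each of
    the \<open>L\<close> others is a constant times \<open>d * d\<close>; this gives the exponent
    \<open>2 * L + 2\<close> and the value of \<open>C\<close>, which stays open until the
    end.\<close>
  have "real (d + 1) * (real ((d + L) * n) * (2 * d)) ^ L
      \<le> real (2 * d * d) * (real (((L + 1) * d) * n) * (2 * d)) ^ L"
  proof (intro mult_mono power_mono)
    have "d + 1 \<le> 2 * d * d" using d by (cases d) auto
    then show "real (d + 1) \<le> real (2 * d * d)" by linarith
    have "d + L \<le> (L + 1) * d" using d by (cases d) auto
    then have "(d + L) * n \<le> (L + 1) * d * n" by (rule mult_right_mono) simp
    then show "real ((d + L) * n) \<le> real ((L + 1) * d * n)" by linarith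
  qed auto
  also have "real (((L + 1) * d) * n) * (2 * d) = (2 * (real L + 1) * n) * (real d)\<^sup>2"
    by (simp add: power2_eq_square algebra_simps)
  also have "real (2 * d * d) * (A * (real d)\<^sup>2) ^ L = 2 * A ^ L * real d ^ (2 * L + 2)" for A :: real
    by (simp add: power_mult_distrib power_add power_mult power2_eq_square)
  finally have poly: "real (d + 1) * (real ((d + L) * n) * (2 * d)) ^ L
      \<le> 2 * (2 * (real L + 1) * n) ^ L * real d ^ (2 * L + 2)" .
  have "exp (t / 2 * d) * (n + 2 * w) ^ d = ((n + 2 * w) * exp (t / 2)) ^ d"
    unfolding power_mult_distrib exp_of_nat2_mult by (rule mult.commute)
  also have "\<dots> \<le> (real n + 8 * real n powr (2 / 3)) ^ d"
  proof (rule power_mono)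
    have "(n + 2 * w) * exp (t / 2) = n * ((1 + 4 * t) * exp (t / 2))"
      unfolding w_def nt [symmetric] by (simp add: algebra_simps)
    also have "\<dots> \<le> n * (1 + 8 * t)" using base_bound t by (intro mult_left_mono) auto
    finally show "(n + 2 * w) * exp (t / 2) \<le> real n + 8 * real n powr (2 / 3)"
      unfolding nt [symmetric] by (simp add: algebra_simps)
  qed (use w1 in simp)
  finally have expo: "exp (t / 2 * d) * (n + 2 * w) ^ d
      \<le> (real n + 8 * real n powr (2 / 3)) ^ d" .
  have "real (d + 1) * (real ((d + L) * n) * (2 * d)) ^ L * (exp (t / 2 * d) * (n + 2 * w) ^ d)
      \<le> 2 * (2 * (real L + 1) * n) ^ L * real d ^ (2 * L + 2)
          * (real n + 8 * real n powr (2 / 3)) ^ d"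
    using w1 by (intro mult_mono poly expo) auto
  then show "finite (level_set n S l) \<and> real (card (level_set n S l))
       \<le> 2 * (2 * (real L + 1) * n) ^ L * real d ^ (2 * L + 2)
           * (real n + 8 * real n powr (2 / 3)) ^ d"
    using bd by linarith
qed

end
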